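(* Let $k$ be a number field and let $C$ be an algebraic curve defined over $k$ by $z^2=f(x,y)$, where $f\in k[x,y]$ is homogeneous with $\deg(f)\ge 2$. Then there exists an infinite quadratic geometric progression sequence on $C$, and there exists an infinite quadratic arithmetic progression sequence on $C$.
   Context: $k$ is a number field with fixed algebraic closure $\overline{k}$. Only points of $C$ in the affine chart $y=1$ are needed: for a field $\ell$ with $k\subseteq \ell\subseteq\overline{k}$, a point $(x,1,z)$ of $C$ over $\ell$ is a pair $x,z\in \ell$ with $z^2=f(x,1)$. The set of quadratic points is $\Gamma_2(C,k)=\bigcup_{[\ell:k]=2}C(\ell)$, the union being over all quadratic extensions $\ell/k$ inside $\overline{k}$ (in particular it contains the $k$-rational points). A quadratic geometric progression sequence on $C$ is a sequence of points $P_i=(x_i,1,z_i)\in \Gamma_2(C,k)$, $i=1,2,\ldots$, with $x_i\in k$, such that there exist $t,t'\in k^*$ with $x_i=t't^i$ for all $i$. A quadratic arithmetic progression sequence on $C$ is a sequence of points $P_i=(x_i,1,z_i)\in\Gamma_2(C,k)$, $i=1,2,\ldots$, with $x_i\in k$, such that there exist $t,t'\in k^*$ with $x_i=t'+it$ for all $i$. Progressions are regarded as sets of points: such a sequence is called infinite if it is indexed by all positive integers and contains infinitely many distinct points $P_i$, and finite otherwise. *)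

theory Defs
  imports "HOL-Algebra.Algebraic_Closure_Type"
begin

text \<open>
  The number field \<open>k\<close> is a type \<open>'a\<close>, its fixed algebraic closure is \<open>'a alg_closure\<close>, and
  \<open>k\<close> sits inside the closure as \<open>range to_ac\<close>. The record \<open>ring_of_type_algebra\<close> is the
  type-class field itself viewed as a \<open>HOL-Algebra\<close> ring with carrier \<open>UNIV\<close>, which gives
  access to \<open>subfield\<close> and to the degree \<open>dimension\<close> of field extensions.
\<close>

definition number_field :: "'a :: field_char_0 itself \<Rightarrow> bool" where
  "number_field _ \<longleftrightarrow> ring.finite_dimension (ring_of_type_algebra :: 'a ring) \<rat> UNIV"

definition quadratic_extension :: "'a :: field alg_closure set \<Rightarrow> bool" where
  "quadratic_extension L \<longleftrightarrow>
     subfield L ring_of_type_algebra \<and> range to_ac \<subseteq> L \<and>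
     ring.dimension ring_of_type_algebra 2 (range to_ac) L"

text \<open>
  Elements of \<open>k[x,y]\<close> are represented as polynomials in \<open>x\<close> with coefficients in \<open>k[y]\<close>:
  \<open>coeff (coeff f i) j\<close> is the coefficient of the monomial $x^i y^j$.
\<close>

definition homogeneous :: "nat \<Rightarrow> 'a :: zero poly poly \<Rightarrow> bool" where
  "homogeneous d f \<longleftrightarrow> (\<forall>i j. coeff (coeff f i) j \<noteq> 0 \<longrightarrow> i + j = d)"

definition eval2 :: "'a :: comm_ring_1 poly poly \<Rightarrow> 'a \<Rightarrow> 'a \<Rightarrow> 'a" where
  "eval2 f x y = poly (poly f [:x:]) y"

definition curve_points ::
  "'a :: field poly poly \<Rightarrow> 'a alg_closure set \<Rightarrow>
    ('a alg_closure \<times> 'a alg_closure \<times> 'a alg_closure) set" where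
  "curve_points f L =
     {(x, 1, z) | x z. x \<in> L \<and> z \<in> L \<and> z ^ 2 = eval2 (map_poly (map_poly to_ac) f) x 1}"

definition quadratic_points ::
  "'a :: field poly poly \<Rightarrow> ('a alg_closure \<times> 'a alg_closure \<times> 'a alg_closure) set" where
  "quadratic_points f = (\<Union>L\<in>{L. quadratic_extension L}. curve_points f L)"

text \<open>Sequences are indexed by the positive integers; the value at index 0 is irrelevant.\<close>

definition quadratic_gp_sequence ::
  "'a :: field poly poly \<Rightarrow> (nat \<Rightarrow> 'a alg_closure \<times> 'a alg_closure \<times> 'a alg_closure) \<Rightarrow> bool" where
  "quadratic_gp_sequence f P \<longleftrightarrow>
     (\<forall>i\<ge>1. P i \<in> quadratic_points f \<and> fst (P i) \<in> range to_ac) \<and>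
     (\<exists>t t'. t \<noteq> 0 \<and> t' \<noteq> 0 \<and> (\<forall>i\<ge>1. fst (P i) = to_ac (t' * t ^ i)))"

definition quadratic_ap_sequence ::
  "'a :: field poly poly \<Rightarrow> (nat \<Rightarrow> 'a alg_closure \<times> 'a alg_closure \<times> 'a alg_closure) \<Rightarrow> bool" where
  "quadratic_ap_sequence f P \<longleftrightarrow>
     (\<forall>i\<ge>1. P i \<in> quadratic_points f \<and> fst (P i) \<in> range to_ac) \<and>
     (\<exists>t t'. t \<noteq> 0 \<and> t' \<noteq> 0 \<and> (\<forall>i\<ge>1. fst (P i) = to_ac (t' + of_nat i * t)))"

end

theory Submission
  imports Defs
begin

text \<open>
  Over every \<open>x \<in> k\<close> there is a point of the curve whose \<open>z\<close>-coordinate is a square root of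
  \<open>f(x,1) \<in> k\<close>, hence lies in \<open>k\<close> or generates a quadratic extension; so any \<open>x\<^sub>i\<close> will do.
  If \<open>z \<in> k\<close>, one still needs some quadratic extension of \<open>k\<close> to exist, that is, a non-square
  in \<open>k\<close>. If all elements of \<open>k\<close> were squares, \<open>k\<close> would contain a \<open>2\<^sup>m\<close>-th root of 2 for every
  \<open>m\<close>; such a root has degree \<open>2\<^sup>m\<close> over the rationals, so \<open>k\<close> would have infinite degree.
\<close>

section \<open>Degree over the rationals of an \<open>n\<close>-th root of 2\<close>

lemma map_poly_of_rat_add:
  "map_poly of_rat (p + q) = (map_poly of_rat p + map_poly of_rat q :: 'a :: field_char_0 poly)"
  by (intro poly_eqI) (simp add: coeff_map_poly of_rat_add)

lemma map_poly_of_rat_mult: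
  "map_poly of_rat (p * q) = (map_poly of_rat p * map_poly of_rat q :: 'a :: field_char_0 poly)"
  by (intro poly_eqI) (simp add: coeff_map_poly coeff_mult of_rat_sum of_rat_mult)

lemma map_poly_of_rat_monom_minus_2:
  "map_poly of_rat (monom 1 n - [:2:]) = (monom 1 n - [:2:] :: 'a :: field_char_0 poly)"
  by (intro poly_eqI) (auto simp: coeff_map_poly of_rat_diff coeff_pCons split: nat.splits)

lemma norm_of_rat_complex: "norm (of_rat x :: complex) = of_rat \<bar>x\<bar>"
proof -
  obtain a b :: int where x: "x = of_int a / of_int b"
    by (metis quotient_of_div prod.exhaust)
  show ?thesis
    by (simp add: x of_rat_divide norm_divide flip: of_int_abs)
qed

text \<open>Compare 2-adic valuations after clearing denominators: \<open>n\<close> divides the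
  valuations of \<open>a ^ n\<close> and \<open>b ^ n\<close>, hence also their difference
  \<open>e\<close>.\<close>

lemma rat_power_eq_2_power_imp_dvd:
  fixes c :: rat
  assumes "c ^ n = 2 ^ e"
  shows "n dvd e"
proof -
  obtain a b :: int where c: "c = of_int a / of_int b" and b: "b > 0"
    by (metis quotient_of_div quotient_of_denom_pos prod.exhaust)
  have "of_int a ^ n = (2 ^ e * of_int b ^ n :: rat)"
    using assms b by (simp add: c power_divide field_simps)
  then have "of_int (a ^ n) = (of_int (2 ^ e * b ^ n) :: rat)"
    by simp
  then have eq: "a ^ n = 2 ^ e * b ^ n"
    by (simp only: of_int_eq_iff)
  show ?thesis
  proof (cases "n = 0")
    case True
    with assms show ?thesis
      by (metis dvd_0_right one_less_numeral_iff one_less_power order_less_irrefl power_0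
            semiring_norm(76) zero_less_iff_neq_zero)
  next
    case False
    then have a: "a \<noteq> 0" using eq b by (auto simp: power_0_left)
    have "multiplicity 2 (a ^ n) = multiplicity 2 (2 ^ e * b ^ n)"
      by (simp only: eq)
    then have "n * multiplicity 2 a = e + n * multiplicity 2 b"
      using a b by (simp add: prime_elem_multiplicity_mult_distrib prime_elem_multiplicity_power_distrib)
    then show ?thesis
      by (metis dvd_add_left_iff dvd_triv_left)
  qed
qed

text \<open>All complex roots of a factor \<open>p\<close> of \<open>X\<^sup>n - 2\<close> have absolute value $2^{1/n}$, so the absolute
  value of its constant over its leading coefficient is a rational number whose \<open>n\<close>-th power
  is \<open>2 ^ degree p\<close>.\<close>

lemma dvd_degree_of_dvd_monom_minus_2:
  fixes p :: "rat poly"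
  assumes "p dvd monom 1 n - [:2:]" and n: "n > 0"
  shows "n dvd degree p"
proof -
  define P :: "complex poly" where "P = map_poly of_rat p"
  obtain q where q: "monom 1 n - [:2:] = p * q"
    using assms by blast
  have p0: "p \<noteq> 0"
  proof
    assume "p = 0"
    then have "coeff (monom 1 n - [:2:] :: rat poly) n = 0"
      by (simp add: q)
    then show False using n by (simp add: coeff_pCons split: nat.splits)
  qed
  have deg: "degree P = degree p" and lc: "lead_coeff P = of_rat (lead_coeff p)"
    by (simp_all add: P_def coeff_map_poly degree_map_poly)
  \<comment> \<open>Over the complex numbers \<open>P\<close> splits into linear factors, with roots
    listed with multiplicity.\<close>
  obtain rt where rt: "smult (lead_coeff P) (\<Prod>i<degree P. [:- rt i, 1:]) = P"
    using complex_poly_decompose' by blast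
  have "map_poly of_rat (monom 1 n - [:2:]) = (monom 1 n - [:2:] :: complex poly)"
    by (rule map_poly_of_rat_monom_minus_2)
  then have PQ: "monom 1 n - [:2:] = P * map_poly of_rat q"
    by (simp add: q P_def map_poly_of_rat_mult)
  have norm_rt: "norm (rt i) ^ n = 2" if "i < degree P" for i
  proof -
    have "poly P (rt i) = 0"
      by (subst rt [symmetric]) (use that in \<open>auto simp: poly_prod\<close>)
    then have "poly (monom 1 n - [:2:]) (rt i) = 0"
      by (simp add: PQ)
    then have "rt i ^ n = 2"
      by (simp add: poly_monom)
    then show ?thesis
      by (metis norm_numeral norm_power)
  qed
  have "poly P 0 = lead_coeff P * (\<Prod>i<degree P. - rt i)"
    by (subst rt [symmetric]) (simp add: poly_prod)
  then have "norm (poly P 0 / lead_coeff P) = (\<Prod>i<degree P. norm (rt i))"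
    using p0 by (simp add: lc norm_mult norm_divide flip: prod_norm)
  then have "norm (poly P 0 / lead_coeff P) ^ n = (\<Prod>i<degree P. norm (rt i) ^ n)"
    by (simp add: prod_power_distrib)
  also have "\<dots> = 2 ^ degree p"
    by (simp add: norm_rt deg)
  also have "poly P 0 = of_rat (poly p 0)"
    by (simp add: P_def poly_0_coeff_0 coeff_map_poly)
  also have "of_rat (poly p 0) / lead_coeff P = of_rat (poly p 0 / lead_coeff p)"
    by (simp only: lc of_rat_divide)
  also have "norm (of_rat (poly p 0 / lead_coeff p) :: complex)
      = of_rat \<bar>poly p 0 / lead_coeff p\<bar>"
    by (rule norm_of_rat_complex)
  \<comment> \<open>Both sides are images of rationals in the reals, so the equation descends to the
    rationals.\<close>
  finally have "of_rat (\<bar>poly p 0 / lead_coeff p\<bar> ^ n) = (of_rat (2 ^ degree p) :: real)"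
    by (simp add: of_rat_power)
  then show ?thesis
    by (intro rat_power_eq_2_power_imp_dvd) (simp only: of_rat_eq_iff)
qed

text \<open>A minimal polynomial \<open>m\<close> of \<open>r\<close> divides
  \<open>X^n - 2\<close>, so \<open>n\<close> divides its degree. That degree is positive, hence at
  least \<open>n\<close>, and \<open>p\<close> cannot have smaller degree than
  \<open>m\<close>.\<close>

lemma degree_ge_of_root_of_2:
  fixes r :: "'a :: field_char_0"
  assumes r: "r ^ n = 2" and "p \<noteq> 0" and "poly (map_poly of_rat p) r = 0"
  shows "degree p \<ge> n"
proof (cases "n = 0")
  case False
  define good where "good = (\<lambda>p. p \<noteq> 0 \<and> poly (map_poly of_rat p) r = 0)"
  obtain m where m: "good m" and min: "\<And>q. good q \<Longrightarrow> degree m \<le> degree q"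
    using assms(2,3) ex_has_least_nat[of good p degree] by (auto simp: good_def)
  \<comment> \<open>The remainder vanishes at \<open>r\<close> as well, so minimality of the degree
    of \<open>m\<close> forces it to be 0.\<close>
  define R where "R = (monom 1 n - [:2:]) mod m"
  have "map_poly of_rat (monom 1 n - [:2:]) = (monom 1 n - [:2:] :: 'a poly)"
    by (rule map_poly_of_rat_monom_minus_2)
  moreover have "monom 1 n - [:2:] = (monom 1 n - [:2:]) div m * m + R"
    by (simp add: R_def)
  ultimately have "monom 1 n - [:2:] =
      map_poly of_rat ((monom 1 n - [:2:]) div m) * map_poly of_rat m + (map_poly of_rat R :: 'a poly)"
    by (metis map_poly_of_rat_add map_poly_of_rat_mult)
  then have "poly (monom 1 n - [:2:]) r = poly (map_poly of_rat R) r"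
    using m by (simp add: good_def)
  then have "poly (map_poly of_rat R) r = 0"
    by (simp add: poly_monom r)
  moreover have "R = 0 \<or> degree R < degree m"
    using m degree_mod_less[of m "monom 1 n - [:2:]"] by (auto simp: R_def good_def)
  ultimately have "R = 0"
    using min[of R] by (meson good_def not_le)
  then have "n dvd degree m"
    using False by (intro dvd_degree_of_dvd_monom_minus_2) (auto simp: R_def)
  \<comment> \<open>Without this, \<open>n dvd degree m\<close> would allow degree 0; but a nonzero
    constant has no root.\<close>
  moreover have "degree m \<noteq> 0"
  proof
    assume "degree m = 0"
    then obtain c where "m = [:c:]" by (metis degree_eq_zeroE)
    then show False using m by (simp add: good_def map_poly_pCons)
  qed
  ultimately have "n \<le> degree m" by (simp add: dvd_imp_le)
  also have "\<dots> \<le> degree p" using assms(2,3) by (intro min) (simp add: good_def)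
  finally show ?thesis .
qed simp

section \<open>Linear algebra in the type-class field viewed as a ring record\<close>

lemma ring_of_type_algebra_simps [simp]:
  "carrier ring_of_type_algebra = UNIV"
  "x \<otimes>\<^bsub>ring_of_type_algebra\<^esub> y = x * y"
  "x \<oplus>\<^bsub>ring_of_type_algebra\<^esub> y = x + y"
  "\<one>\<^bsub>ring_of_type_algebra\<^esub> = 1"
  "\<zero>\<^bsub>ring_of_type_algebra\<^esub> = 0"
  by (simp_all add: ring_of_type_algebra_def)

lemma a_inv_ring_of_type_algebra [simp]:
  "\<ominus>\<^bsub>ring_of_type_algebra\<^esub> (x :: 'a :: comm_ring_1) = - x"
proof -
  interpret R: ring "ring_of_type_algebra :: 'a ring"
    by (rule ring_from_type_algebra)
  show ?thesis
    using R.minus_equality[of "- x" x] by simp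
qed

lemma m_inv_ring_of_type_algebra [simp]:
  assumes "x \<noteq> (0 :: 'a :: field)"
  shows "inv\<^bsub>ring_of_type_algebra\<^esub> x = inverse x"
proof -
  interpret R: field "ring_of_type_algebra :: 'a ring"
    by (rule field_from_type_algebra)
  show ?thesis
    using R.comm_inv_char[of x "inverse x"] assms by simp
qed

lemma subfield_ring_of_type_algebraI:
  fixes K :: "'a :: field set"
  assumes "1 \<in> K" "\<And>x. x \<in> K \<Longrightarrow> - x \<in> K"
    and "\<And>x y. x \<in> K \<Longrightarrow> y \<in> K \<Longrightarrow> x * y \<in> K" "\<And>x y. x \<in> K \<Longrightarrow> y \<in> K \<Longrightarrow> x + y \<in> K"
    and "\<And>x. x \<in> K \<Longrightarrow> x \<noteq> 0 \<Longrightarrow> inverse x \<in> K"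
  shows "subfield K ring_of_type_algebra"
proof -
  interpret R: field "ring_of_type_algebra :: 'a ring"
    by (rule field_from_type_algebra)
  show ?thesis
    by (intro R.subfieldI' R.subringI) (use assms in auto)
qed

lemma line_extension_ring_of_type_algebra:
  fixes K E :: "'a :: comm_ring_1 set"
  shows "ring.line_extension ring_of_type_algebra K a E = {k * a + v | k v. k \<in> K \<and> v \<in> E}"
proof -
  interpret R: ring "ring_of_type_algebra :: 'a ring"
    by (rule ring_from_type_algebra)
  show ?thesis
    unfolding set_eq_iff R.line_extension_mem_iff by (simp; blast)
qed

text \<open>This is Horner's scheme: splitting off the first scalar replaces \<open>c\<close> by
  \<open>c * r\<close>, so the induction needs \<open>c\<close> arbitrary. The \<open>take n\<close>
  reflects that \<open>combine\<close> stops at the end of the shorter list.\<close>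

lemma combine_ring_of_type_algebra_powers:
  fixes r :: "'a :: comm_ring_1"
  shows "ring.combine ring_of_type_algebra Ks (map (\<lambda>i. c * r ^ i) [0..<n])
    = c * poly (Poly (take n Ks)) r"
proof -
  interpret R: ring "ring_of_type_algebra :: 'a ring"
    by (rule ring_from_type_algebra)
  show ?thesis
  proof (induction Ks arbitrary: c n)
    case (Cons k Ks)
    show ?case
    proof (cases n)
      case (Suc m)
      have "map (\<lambda>i. c * r ^ i) [0..<n] = c # map (\<lambda>i. (c * r) * r ^ i) [0..<m]"
        by (simp add: Suc upt_conv_Cons map_Suc_upt [symmetric] mult.assoc comp_def
              del: upt_Suc)
      then show ?thesis
        using Cons[of "c * r" m] by (simp add: Suc algebra_simps)
    qed simp
  qed simp
qed

text \<open>The \<open>n + 1\<close> powers \<open>1, r, ..., r ^ n\<close> are linearly dependent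
  over the rationals; the coefficients of a nontrivial relation form the polynomial.\<close>

lemma finite_dimension_imp_root_rat_poly:
  fixes r :: "'a :: field_char_0"
  assumes "ring.dimension ring_of_type_algebra n \<rat> (UNIV :: 'a set)"
  obtains p where "p \<noteq> 0" "degree p \<le> n" "poly (map_poly of_rat p) r = 0"
proof -
  interpret R: ring "ring_of_type_algebra :: 'a ring"
    by (rule ring_from_type_algebra)
  have K: "subfield \<rat> (ring_of_type_algebra :: 'a ring)"
    by (rule subfield_ring_of_type_algebraI) auto
  define Us where "Us = map (\<lambda>i. r ^ i) [0..<Suc n]"
  have "\<not> R.independent \<rat> Us"
    using R.independent_length_le_dimension[OF K assms, of Us] by (auto simp: Us_def)
  \<comment> \<open>Scalars beyond the length of \<open>Us\<close> do not affect the combination, so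
    nontriviality concerns the truncated list.\<close>
  then obtain Ks where Ks: "set Ks \<subseteq> \<rat>" "R.combine Ks Us = 0"
    and nz: "\<not> set (take (length Us) Ks) \<subseteq> {0}"
    using R.trivial_combine_imp_independent[OF K, of Us] by auto
  define Q where "Q = Poly (take (Suc n) Ks)"
  have "poly Q r = 0"
    using Ks(2) combine_ring_of_type_algebra_powers[of Ks 1 r "Suc n"]
    by (simp add: Us_def Q_def del: upt_Suc)
  moreover have "Q \<noteq> 0"
    using nz by (auto simp: Q_def Us_def Poly_eq_0)
  moreover have "degree Q \<le> n"
    by (intro degree_le) (auto simp: Q_def nth_default_def)
  \<comment> \<open>\<open>Q\<close> lives over the big field; its coefficients are pulled back one
    by one to obtain a genuine rational polynomial.\<close>
  moreover have "\<exists>q. coeff Q i = of_rat q" for i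
  proof (cases "i < length (take (Suc n) Ks)")
    case True
    then have "take (Suc n) Ks ! i \<in> set Ks"
      by (meson in_set_takeD nth_mem)
    then have "coeff Q i \<in> \<rat>"
      using True Ks(1) by (auto simp: Q_def nth_default_def)
    then show ?thesis by (auto elim: Rats_cases)
  next
    case False
    then have "coeff Q i = of_rat 0"
      by (auto simp: Q_def nth_default_def)
    then show ?thesis by blast
  qed
  then obtain g where g: "\<And>i. coeff Q i = of_rat (g i)"
    by metis
  moreover define p where "p = Abs_poly g"
  moreover have "coeff p = g"
    unfolding p_def
  proof (rule Abs_poly_inverse)
    have "\<forall>\<^sub>\<infinity>i. coeff Q i = 0" by (rule MOST_coeff_eq_0)
    then show "g \<in> {f. \<forall>\<^sub>\<infinity>n. f n = 0}" by (simp add: g)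
  qed
  ultimately have "map_poly of_rat p = Q"
    by (intro poly_eqI) (simp add: coeff_map_poly)
  then have "degree p = degree Q" "p \<noteq> 0"
    using \<open>Q \<noteq> 0\<close> by (auto simp: degree_map_poly)
  with \<open>map_poly of_rat p = Q\<close> \<open>poly Q r = 0\<close> \<open>degree Q \<le> n\<close> show ?thesis
    by (intro that[of p]) auto
qed

lemma number_field_nonsquare:
  assumes "number_field TYPE('a :: field_char_0)"
  obtains b :: "'a :: field_char_0" where "\<And>c. c\<^sup>2 \<noteq> b"
proof -
  interpret R: ring "ring_of_type_algebra :: 'a ring"
    by (rule ring_from_type_algebra)
  obtain n where n: "R.dimension n \<rat> (UNIV :: 'a set)"
    using assms unfolding number_field_def R.finite_dimension_def by blast
  have False if sq: "\<And>b :: 'a. \<exists>c. c\<^sup>2 = b"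
  proof -
    have "\<exists>r :: 'a. r ^ (2 ^ m) = 2" for m
    proof (induction m)
      case (Suc m)
      then obtain r :: 'a where r: "r ^ (2 ^ m) = 2" by blast
      obtain c where "c\<^sup>2 = r" using sq by blast
      then show ?case using r by (auto simp: power_mult)
    qed simp
    \<comment> \<open>Taking the dimension \<open>n\<close> itself as exponent suffices: it gives
      \<open>2 ^ n \<le> n\<close>.\<close>
    then obtain r :: 'a where r: "r ^ (2 ^ n) = 2" by blast
    obtain p where "p \<noteq> 0" "degree p \<le> n" "poly (map_poly of_rat p) r = 0"
      using finite_dimension_imp_root_rat_poly[OF n] by blast
    with degree_ge_of_root_of_2[OF r] have "2 ^ n \<le> n" by fastforce
    then show False using less_exp[of n] by simp
  qed
  with that show thesis by blast
qed

section \<open>Quadratic extensions containing a given square root\<close>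

lemma quadratic_extension_adjoin_sqrt:
  fixes w :: "'a :: field alg_closure"
  assumes w: "w\<^sup>2 = to_ac a" and nr: "w \<notin> range to_ac"
  shows "quadratic_extension {to_ac x * w + to_ac y | x y. True}"
    (is "quadratic_extension ?L")
proof -
  interpret R: field "ring_of_type_algebra :: 'a alg_closure ring"
    by (rule field_from_type_algebra)
  have L: "to_ac x * w + to_ac y \<in> ?L" for x y by blast
  have "subfield ?L ring_of_type_algebra"
  proof (rule subfield_ring_of_type_algebraI)
    show "1 \<in> ?L" using L[of 0 1] by simp
  next
    fix u assume "u \<in> ?L"
    then obtain x y where "u = to_ac x * w + to_ac y" by blast
    then show "- u \<in> ?L" using L[of "-x" "-y"] by simp
  next
    fix u v assume "u \<in> ?L" "v \<in> ?L"
    then obtain x y x' y' where u: "u = to_ac x * w + to_ac y" and v: "v = to_ac x' * w + to_ac y'"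
      by blast
    show "u + v \<in> ?L" using L[of "x + x'" "y + y'"] by (simp add: u v algebra_simps)
    have "u * v = to_ac x * to_ac x' * w\<^sup>2 + (to_ac x * to_ac y' + to_ac y * to_ac x') * w
        + to_ac y * to_ac y'"
      by (simp add: u v algebra_simps power2_eq_square)
    then show "u * v \<in> ?L"
      using L[of "x * y' + y * x'" "x * x' * a + y * y'"] by (simp add: w algebra_simps)
  next
    fix u assume "u \<in> ?L" and u0: "u \<noteq> 0"
    then obtain x y where u: "u = to_ac x * w + to_ac y" by blast
    \<comment> \<open>The conjugate of \<open>u\<close>: the product \<open>u * v\<close> is the
      norm and lies in the base field, which yields the inverse of \<open>u\<close>.\<close>
    define v where "v = to_ac y - to_ac x * w"
    have v0: "v \<noteq> 0"
    proof
      assume v: "v = 0"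
      show False
      proof (cases "x = 0")
        case True
        then show False using v u0 by (simp add: v_def u)
      next
        case False
        then have "w = to_ac (y / x)" using v by (simp add: v_def field_simps)
        then show False using nr by blast
      qed
    qed
    have uv: "u * v = to_ac (y\<^sup>2 - x\<^sup>2 * a)"
      by (simp add: u v_def algebra_simps power2_eq_square flip: w)
    define D where "D = y\<^sup>2 - x\<^sup>2 * a"
    have "inverse u = v * inverse (u * v)"
      using u0 v0 by (simp add: field_simps)
    also have "\<dots> = to_ac (- x * inverse D) * w + to_ac (y * inverse D)"
      unfolding uv by (simp add: v_def D_def algebra_simps)
    finally show "inverse u \<in> ?L" using L by metis
  qed
  moreover have "range to_ac \<subseteq> ?L"
  proof
    fix u :: "'a alg_closure" assume "u \<in> range to_ac"
    then obtain y where "u = to_ac y" by blast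
    then show "u \<in> ?L" using L[of 0 y] by simp
  qed
  \<comment> \<open>The dimension is built up from \<open>{0}\<close> by adjoining the basis vectors
    1 and then \<open>w\<close>; the inner line extension is the base field itself.\<close>
  moreover have "R.dimension (Suc (Suc 0)) (range to_ac)
      (R.line_extension (range to_ac) w (R.line_extension (range to_ac) 1 {0}))"
  proof (intro R.Suc_dim)
    show "w \<notin> R.line_extension (range to_ac) 1 {0}"
      using nr by (simp add: line_extension_ring_of_type_algebra image_iff)
    show "R.dimension 0 (range to_ac) {0}"
      using R.zero_dim[of "range to_ac"] by simp
  qed simp_all
  moreover have "R.line_extension (range to_ac) w (R.line_extension (range to_ac) 1 {0}) = ?L"
    by (auto simp: line_extension_ring_of_type_algebra)
  ultimately show ?thesis
    by (simp add: quadratic_extension_def numeral_2_eq_2)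
qed

lemma sqrt_in_quadratic_extension:
  fixes z :: "'a :: field_char_0 alg_closure"
  assumes "number_field TYPE('a)" and z: "z\<^sup>2 = to_ac a"
  obtains L where "quadratic_extension L" "z \<in> L"
proof (cases "z \<in> range to_ac")
  case False
  have "z = to_ac 1 * z + to_ac 0" by simp
  with quadratic_extension_adjoin_sqrt[OF z False] that show ?thesis by blast
next
  case True
  obtain b :: 'a where b: "\<And>c. c\<^sup>2 \<noteq> b"
    using number_field_nonsquare[OF assms(1)] by blast
  obtain w where w: "w\<^sup>2 = to_ac b"
    using nth_root_exists[of 2 "to_ac b"] by auto
  \<comment> \<open>Since \<open>to_ac\<close> is injective, a preimage of \<open>w\<close> would be
    a square root of \<open>b\<close>.\<close>
  have "w \<notin> range to_ac"
    using w b by (auto simp flip: to_ac_power)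
  from quadratic_extension_adjoin_sqrt[OF w this] that True show ?thesis
    unfolding quadratic_extension_def by blast
qed

section \<open>Points on the curve and the two progressions\<close>

text \<open>As \<open>to_ac\<close> is a ring homomorphism, \<open>z\<close> is a square root of an
  element of the base field whenever \<open>x\<close> lies in it.\<close>

lemma eval2_map_poly_to_ac:
  "eval2 (map_poly (map_poly to_ac) f) (to_ac x) (to_ac y) = to_ac (eval2 f x y)"
proof -
  have ev: "poly (map_poly to_ac p) (to_ac y) = to_ac (poly p y)" for p y
    by (induction p) (simp_all add: map_poly_pCons)
  show ?thesis
    unfolding eval2_def
    by (induction f) (simp_all add: map_poly_pCons ev)
qed

lemma ex_quadratic_point:
  fixes x :: "'a :: field_char_0"
  assumes "number_field TYPE('a)"
  shows "\<exists>z. (to_ac x, 1, z) \<in> quadratic_points f"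
proof -
  obtain z where z: "z\<^sup>2 = to_ac (eval2 f x 1)"
    using nth_root_exists[of 2 "to_ac (eval2 f x 1)"] by auto
  obtain L where L: "quadratic_extension L" "z \<in> L"
    using sqrt_in_quadratic_extension[OF assms z] .
  moreover have "to_ac x \<in> L"
    using L(1) by (auto simp: quadratic_extension_def)
  moreover have "z\<^sup>2 = eval2 (map_poly (map_poly to_ac) f) (to_ac x) 1"
    using z eval2_map_poly_to_ac[of f x 1] by simp
  ultimately show ?thesis
    unfolding quadratic_points_def curve_points_def by blast
qed

text \<open>Points with distinct first coordinates are distinct, whichever square roots are chosen
  for \<open>z\<close>.\<close>

lemma ex_quadratic_point_sequence:
  fixes x :: "nat \<Rightarrow> 'a :: field_char_0"
  assumes "number_field TYPE('a)" and "inj x"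
  obtains P where "\<And>i. P i \<in> quadratic_points f" "\<And>i. fst (P i) = to_ac (x i)"
    "infinite (P ` {1..})"
proof -
  have "\<forall>i. \<exists>z. (to_ac (x i), 1, z) \<in> quadratic_points f"
    using ex_quadratic_point[OF assms(1)] by blast
  from choice[OF this] obtain z where z: "\<And>i. (to_ac (x i), 1, z i) \<in> quadratic_points f"
    by blast
  have "inj (\<lambda>i. (to_ac (x i), 1 :: 'a alg_closure, z i))"
    using assms(2) by (auto simp: inj_on_def)
  then have "infinite ((\<lambda>i. (to_ac (x i), 1 :: 'a alg_closure, z i)) ` {1..})"
    by (meson finite_imageD infinite_Ici inj_on_subset subset_UNIV)
  with z show ?thesis
    by (intro that[of "\<lambda>i. (to_ac (x i), 1, z i)"]) auto
qed

theorem lemma4p2: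
  fixes f :: "'a :: field_char_0 poly poly" and d :: nat
  assumes "number_field TYPE('a)"
    and "f \<noteq> 0" and "homogeneous d f" and "d \<ge> 2"
  shows "(\<exists>P. quadratic_gp_sequence f P \<and> infinite (P ` {1..})) \<and>
         (\<exists>P. quadratic_ap_sequence f P \<and> infinite (P ` {1..}))"
proof
  \<comment> \<open>Powers of 2 are distinct in characteristic 0. The factor 1 is kept to match
    \<open>t' * t ^ i\<close> with \<open>t' = 1\<close> and \<open>t = 2\<close>.\<close>
  have "inj (\<lambda>i. 1 * 2 ^ i :: 'a)"
  proof (rule injI)
    fix i j :: nat
    assume "1 * 2 ^ i = (1 * 2 ^ j :: 'a)"
    then have "of_nat (2 ^ i) = (of_nat (2 ^ j) :: 'a)" by simp
    then show "i = j" by (simp only: of_nat_eq_iff) simp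
  qed
  from ex_quadratic_point_sequence[OF assms(1) this, of f] obtain P where
    "\<And>i. P i \<in> quadratic_points f" "\<And>i. fst (P i) = to_ac (1 * 2 ^ i)" "infinite (P ` {1..})"
    by metis
  then show "\<exists>P. quadratic_gp_sequence f P \<and> infinite (P ` {1..})"
    unfolding quadratic_gp_sequence_def
    by (intro exI[of _ P] conjI exI[of _ "2 :: 'a"] exI[of _ "1 :: 'a"])
      (auto simp del: to_ac_power to_ac_mult)
next
  \<comment> \<open>Likewise, this matches \<open>t' + of_nat i * t\<close> with both parameters
    equal to 1.\<close>
  have "inj (\<lambda>i. 1 + of_nat i * 1 :: 'a)"
    by (auto simp: inj_on_def)
  from ex_quadratic_point_sequence[OF assms(1) this, of f] obtain P where
    "\<And>i. P i \<in> quadratic_points f" "\<And>i. fst (P i) = to_ac (1 + of_nat i * 1)" "infinite (P ` {1..})"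
    by metis
  then show "\<exists>P. quadratic_ap_sequence f P \<and> infinite (P ` {1..})"
    unfolding quadratic_ap_sequence_def
    by (intro exI[of _ P] conjI exI[of _ "1 :: 'a"])
      (auto simp del: to_ac_add to_ac_of_nat)
qed

end
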